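(* As classes of (families of) Boolean functions, \[ \overline{\mathrm{NN}} = \mathrm{mpPTF}(\infty), \qquad \overline{\mathrm{HNN}} = \mathrm{mpPTF}(\mathrm{poly}(n)). \]
   Context: All classes below are classes of families $(f_n)_{n\ge 1}$ of Boolean functions $f_n:\{0,1\}^n\to\{0,1\}$, and "polynomial" means polynomial in $n$. Let $\Delta(\mathbf{x},\mathbf{y})=\|\mathbf{x}-\mathbf{y}\|_2^2$. A nearest neighbor (NN) representation of $f:\{0,1\}^n\to\{0,1\}$ is a pair of disjoint finite sets $P,N\subseteq\mathbb{R}^n$ (anchors) such that $f(\mathbf{x})=1$ if there is $\mathbf{p}\in P$ with $\Delta(\mathbf{x},\mathbf{p})<\Delta(\mathbf{x},\mathbf{q})$ for all $\mathbf{q}\in N$, and $f(\mathbf{x})=0$ if there is $\mathbf{q}\in N$ with $\Delta(\mathbf{x},\mathbf{q})<\Delta(\mathbf{x},\mathbf{p})$ for all $\mathbf{p}\in P$; the number of anchors is $|P|+|N|$. A Hamming nearest neighbor (HNN) representation is the same with $P,N\subseteq\{0,1\}^n$. $\mathrm{NN}$ (resp. $\mathrm{HNN}$) is the class of functions having NN (resp. HNN) representations with polynomially many anchors. A substitution of variables $v:\{0,1\}^n\to\{0,1\}^{\tilde n}$ maps $\mathbf{x}$ to a vector each of whose coordinates is either some $x_i$ (variables may be duplicated) or a constant $0$ or $1$. $f:\{0,1\}^n\to\{0,1\}$ is a subfunction of $g:\{0,1\}^{\tilde n}\to\{0,1\}$ if $\tilde n=\mathrm{poly}(n)$ and there is a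 substitution $v$ with $f(\mathbf{x})=g(v(\mathbf{x}))$ for all $\mathbf{x}$. For a class $C$, its closure $\overline{C}$ is the set of subfunctions of members of $C$. A min-plus polynomial threshold function (mpPTF) is given by linear forms with integer coefficients $L_1,\dots,L_{\ell_1},R_1,\dots,R_{\ell_2}$ (affine functions of $\mathbf{x}$) via $f(\mathbf{x})=1\iff\min_i L_i(\mathbf{x})\le\min_j R_j(\mathbf{x})$; it has $\ell_1+\ell_2$ terms and its maximum weight is the largest absolute value of a coefficient of any form. $\mathrm{mpPTF}(\infty)$ is the class of functions computed by mpPTFs with polynomially many terms and unbounded weights; $\mathrm{mpPTF}(\mathrm{poly}(n))$ additionally requires polynomially bounded maximum weight. *)

theory Defs
  imports Complex_Main "Jordan_Normal_Form.Matrix"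
begin

text \<open>The cube of dimension \<open>n\<close> is \<open>carrier_vec n :: bool vec set\<close>. A family is a function
  \<open>f :: nat \<Rightarrow> bool vec \<Rightarrow> bool\<close>; only the values of \<open>f n\<close> on \<open>carrier_vec n\<close> for \<open>n \<ge> 1\<close>
  matter, and every class below is insensitive to the other values.\<close>

type_synonym bool_family = "nat \<Rightarrow> bool vec \<Rightarrow> bool"

definition poly_bounded :: "(nat \<Rightarrow> nat) \<Rightarrow> bool" where
  "poly_bounded s \<longleftrightarrow> (\<exists>c k. \<forall>n\<ge>1. s n \<le> c * n ^ k)"

abbreviation embed :: "bool vec \<Rightarrow> 'a::zero_neq_one vec" where
  "embed x \<equiv> map_vec of_bool x"

definition sq_dist :: "real vec \<Rightarrow> real vec \<Rightarrow> real" where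
  "sq_dist x y = (\<Sum>i<dim_vec x. (x $ i - y $ i)\<^sup>2)"

text \<open>Both conditions are equivalences, so every input of the cube must be classified: an input
  equally close to \<open>P\<close> and \<open>N\<close> is not allowed, nor is \<open>P = N = {}\<close>. With one-sided implications
  such inputs would be unconstrained, and the empty set of anchors would represent every function.
  One of \<open>P\<close>, \<open>N\<close> may be empty, which gives the constant functions.\<close>

definition nn_rep :: "nat \<Rightarrow> (bool vec \<Rightarrow> bool) \<Rightarrow> real vec set \<Rightarrow> real vec set \<Rightarrow> bool" where
  "nn_rep n f P N \<longleftrightarrow>
     finite P \<and> finite N \<and> P \<subseteq> carrier_vec n \<and> N \<subseteq> carrier_vec n \<and> P \<inter> N = {} \<and>
     (\<forall>x\<in>carrier_vec n.
        (f x \<longleftrightarrow> (\<exists>p\<in>P. \<forall>q\<in>N. sq_dist (embed x) p < sq_dist (embed x) q)) \<and>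
        (\<not> f x \<longleftrightarrow> (\<exists>q\<in>N. \<forall>p\<in>P. sq_dist (embed x) q < sq_dist (embed x) p)))"

definition hnn_rep :: "nat \<Rightarrow> (bool vec \<Rightarrow> bool) \<Rightarrow> real vec set \<Rightarrow> real vec set \<Rightarrow> bool" where
  "hnn_rep n f P N \<longleftrightarrow>
     nn_rep n f P N \<and> P \<subseteq> embed ` carrier_vec n \<and> N \<subseteq> embed ` carrier_vec n"

definition NN :: "bool_family set" where
  "NN = {f. \<exists>P N. (\<forall>n\<ge>1. nn_rep n (f n) (P n) (N n)) \<and>
                  poly_bounded (\<lambda>n. card (P n) + card (N n))}"

definition HNN :: "bool_family set" where
  "HNN = {f. \<exists>P N. (\<forall>n\<ge>1. hnn_rep n (f n) (P n) (N n)) \<and>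
                   poly_bounded (\<lambda>n. card (P n) + card (N n))}"

definition substitution :: "nat \<Rightarrow> nat \<Rightarrow> (bool vec \<Rightarrow> bool vec) \<Rightarrow> bool" where
  "substitution n m v \<longleftrightarrow>
     v \<in> carrier_vec n \<rightarrow> carrier_vec m \<and>
     (\<forall>j<m. (\<exists>i<n. \<forall>x\<in>carrier_vec n. v x $ j = x $ i) \<or>
            (\<exists>c. \<forall>x\<in>carrier_vec n. v x $ j = c))"

definition is_subfunction ::
    "nat \<Rightarrow> (bool vec \<Rightarrow> bool) \<Rightarrow> nat \<Rightarrow> (bool vec \<Rightarrow> bool) \<Rightarrow> bool" where
  "is_subfunction n f m g \<longleftrightarrow> (\<exists>v. substitution n m v \<and> (\<forall>x\<in>carrier_vec n. f x = g (v x)))"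

definition subfun_closure :: "bool_family set \<Rightarrow> bool_family set" where
  "subfun_closure C = {f. \<exists>g\<in>C. \<exists>m. poly_bounded m \<and>
     (\<forall>n\<ge>1. m n \<ge> 1 \<and> is_subfunction n (f n) (m n) (g (m n)))}"

text \<open>The pair \<open>(a, b)\<close> is the affine form \<open>a \<bullet> x + b\<close>.\<close>

type_synonym affine_form = "int vec \<times> int"

definition form_val :: "affine_form \<Rightarrow> bool vec \<Rightarrow> int" where
  "form_val l x = fst l \<bullet> embed x + snd l"

text \<open>Both lists are required to be nonempty, since a minimum over no forms is undefined.\<close>

definition mpptf_computes ::
    "nat \<Rightarrow> (bool vec \<Rightarrow> bool) \<Rightarrow> affine_form list \<Rightarrow> affine_form list \<Rightarrow> bool" where
  "mpptf_computes n f L R \<longleftrightarrow>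
     L \<noteq> [] \<and> R \<noteq> [] \<and> (\<forall>l\<in>set L \<union> set R. fst l \<in> carrier_vec n) \<and>
     (\<forall>x\<in>carrier_vec n. f x \<longleftrightarrow> (MIN l\<in>set L. form_val l x) \<le> (MIN r\<in>set R. form_val r x))"

text \<open>The constant term counts as a coefficient.\<close>

definition max_weight :: "affine_form list \<Rightarrow> affine_form list \<Rightarrow> nat" where
  "max_weight L R =
     Max (\<Union>(a, b)\<in>set L \<union> set R. insert (nat \<bar>b\<bar>) ((\<lambda>i. nat \<bar>a $ i\<bar>) ` {..<dim_vec a}))"

definition mpPTF_unbounded :: "bool_family set" where
  "mpPTF_unbounded = {f. \<exists>L R. (\<forall>n\<ge>1. mpptf_computes n (f n) (L n) (R n)) \<and>
                               poly_bounded (\<lambda>n. length (L n) + length (R n))}"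

definition mpPTF_poly :: "bool_family set" where
  "mpPTF_poly = {f. \<exists>L R. (\<forall>n\<ge>1. mpptf_computes n (f n) (L n) (R n)) \<and>
                          poly_bounded (\<lambda>n. length (L n) + length (R n)) \<and>
                          poly_bounded (\<lambda>n. max_weight (L n) (R n))}"

end

theory Submission
  imports Defs
begin

text \<open>Subtracting the term common to all anchors turns the squared distances from a Boolean point
  into affine forms, so nearest neighbor functions are min-plus threshold functions; since every
  comparison of distances is strict, real coefficients may be scaled and rounded to integers.
  Conversely, the forms of a threshold function become distances after a substitution: copies of the
  variables produce integer coefficients from Boolean anchors, and constant coordinates equalize the
  norms of the anchors. The delicate point is that the anchors must not produce ties anywhere on the
  larger cube, not only on the image of the substitution.\<close>

section \<open>Polynomial bounds\<close>

lemma poly_boundedI: "(\<And>n. n \<ge> 1 \<Longrightarrow> s n \<le> c * n ^ k) \<Longrightarrow> poly_bounded s"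
  unfolding poly_bounded_def by blast

lemma poly_bounded_mono:
  assumes "poly_bounded t" "\<And>n. n \<ge> 1 \<Longrightarrow> s n \<le> t n"
  shows "poly_bounded s"
  using assms unfolding poly_bounded_def by (meson order_trans)

lemma poly_bounded_const: "poly_bounded (\<lambda>_. c)"
  by (rule poly_boundedI[where c = c and k = 0]) simp

lemma poly_bounded_id: "poly_bounded (\<lambda>n. n)"
  by (rule poly_boundedI[where c = 1 and k = 1]) simp

lemma poly_bounded_add:
  assumes "poly_bounded s" "poly_bounded t"
  shows "poly_bounded (\<lambda>n. s n + t n)"
proof -
  obtain c k d l where s: "\<And>n. n \<ge> 1 \<Longrightarrow> s n \<le> c * n ^ k" and t: "\<And>n. n \<ge> 1 \<Longrightarrow> t n \<le> d * n ^ l"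
    using assms unfolding poly_bounded_def by blast
  show ?thesis
  proof (rule poly_boundedI)
    fix n :: nat assume n: "n \<ge> 1"
    have "c * n ^ k \<le> c * n ^ (k + l)" "d * n ^ l \<le> d * n ^ (k + l)"
      using n by (auto intro!: mult_left_mono power_increasing)
    with s[OF n] t[OF n] show "s n + t n \<le> (c + d) * n ^ (k + l)"
      unfolding distrib_right by linarith
  qed
qed

lemma poly_bounded_mult:
  assumes "poly_bounded s" "poly_bounded t"
  shows "poly_bounded (\<lambda>n. s n * t n)"
proof -
  obtain c k d l where s: "\<And>n. n \<ge> 1 \<Longrightarrow> s n \<le> c * n ^ k" and t: "\<And>n. n \<ge> 1 \<Longrightarrow> t n \<le> d * n ^ l"
    using assms unfolding poly_bounded_def by blast
  show ?thesis
  proof (rule poly_boundedI)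
    fix n :: nat assume n: "n \<ge> 1"
    have "s n * t n \<le> (c * n ^ k) * (d * n ^ l)"
      using s[OF n] t[OF n] by (rule mult_le_mono)
    then show "s n * t n \<le> (c * d) * n ^ (k + l)"
      by (simp add: power_add mult_ac)
  qed
qed

text \<open>\<open>poly_bounded\<close> says nothing about the argument 0, so the bound on
  \<open>s\<close> can be applied at \<open>m n\<close> only when \<open>m n\<close> is
  positive.\<close>

lemma poly_bounded_compose:
  assumes "poly_bounded s" "poly_bounded m" "\<And>n. n \<ge> 1 \<Longrightarrow> m n \<ge> 1"
  shows "poly_bounded (\<lambda>n. s (m n))"
proof -
  obtain c k d l where s: "\<And>n. n \<ge> 1 \<Longrightarrow> s n \<le> c * n ^ k" and m: "\<And>n. n \<ge> 1 \<Longrightarrow> m n \<le> d * n ^ l"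
    using assms unfolding poly_bounded_def by blast
  show ?thesis
  proof (rule poly_boundedI)
    fix n :: nat assume n: "n \<ge> 1"
    have "s (m n) \<le> c * m n ^ k" using s assms(3) n by blast
    also have "\<dots> \<le> c * (d * n ^ l) ^ k" using m[OF n] by (simp add: power_mono)
    finally show "s (m n) \<le> (c * d ^ k) * n ^ (l * k)"
      by (simp add: power_mult_distrib power_mult mult.assoc)
  qed
qed

section \<open>Distances and affine forms in coordinates\<close>

lemma finite_bool_cube: "finite (carrier_vec n :: bool vec set)"
proof (rule finite_subset)
  show "carrier_vec n \<subseteq> vec_of_list ` {xs :: bool list. set xs \<subseteq> UNIV \<and> length xs = n}"
  proof
    fix x :: "bool vec" assume "x \<in> carrier_vec n"
    then show "x \<in> vec_of_list ` {xs. set xs \<subseteq> UNIV \<and> length xs = n}"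
      by (intro image_eqI[of _ _ "list_of_vec x"]) (auto simp: vec_list)
  qed
  show "finite (vec_of_list ` {xs :: bool list. set xs \<subseteq> UNIV \<and> length xs = n})"
    by (intro finite_imageI finite_lists_length_eq) simp
qed

lemma sq_dist_embed:
  assumes "x \<in> carrier_vec n"
  shows "sq_dist (embed x) p = (\<Sum>i<n. (of_bool (x $ i) - p $ i)\<^sup>2)"
  using assms by (auto simp: sq_dist_def intro!: sum.cong)

text \<open>A bit equals its square, so the part quadratic in the input does not depend on the
  anchor and the rest is affine.\<close>

lemma sq_dist_embed_expand:
  assumes "x \<in> carrier_vec n"
  shows "sq_dist (embed x) p =
    (\<Sum>i<n. of_bool (x $ i)) + (\<Sum>i<n. - 2 * p $ i * of_bool (x $ i)) + (\<Sum>i<n. (p $ i)\<^sup>2)"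
  unfolding sq_dist_embed[OF assms] sum.distrib[symmetric]
  by (rule sum.cong) (auto simp: power2_eq_square algebra_simps)

lemma form_val_sum:
  assumes "x \<in> carrier_vec n"
  shows "form_val l x = (\<Sum>i<n. fst l $ i * of_bool (x $ i)) + snd l"
  using assms by (auto simp: form_val_def scalar_prod_def lessThan_atLeast0 intro!: sum.cong)

text \<open>Gives the comparison of minima the quantifier shape of \<open>nn_rep\<close>; a
  minimizer on the left is the witness.\<close>

lemma Min_image_le_iff:
  assumes "finite A" "A \<noteq> {}" "finite B" "B \<noteq> {}"
  shows "(MIN a\<in>A. F a) \<le> (MIN b\<in>B. F b) \<longleftrightarrow> (\<exists>a\<in>A. \<forall>b\<in>B. F a \<le> (F b :: 'a :: linorder))"
proof -
  have "(MIN a\<in>A. F a) \<in> F ` A" using assms by (intro Min_in) auto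
  then obtain a where a: "a \<in> A" "(MIN a\<in>A. F a) = F a" by blast
  have "F a \<le> F a'" if "a' \<in> A" for a'
    using Min_le[of "F ` A" "F a'"] assms that a by simp
  moreover have "(MIN a\<in>A. F a) \<le> (MIN b\<in>B. F b) \<longleftrightarrow> (\<forall>b\<in>B. F a \<le> F b)"
    unfolding a(2) using assms by simp
  ultimately show ?thesis using a(1) by (meson order_trans)
qed

text \<open>Lets weight bounds be checked form by form, without the maximum in
  \<open>max_weight\<close>.\<close>

definition form_weight_le :: "nat \<Rightarrow> affine_form \<Rightarrow> bool" where
  "form_weight_le W l \<longleftrightarrow> \<bar>snd l\<bar> \<le> int W \<and> (\<forall>i<dim_vec (fst l). \<bar>fst l $ i\<bar> \<le> int W)"

lemma max_weight_le_iff: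
  assumes "L \<noteq> [] \<or> R \<noteq> []"
  shows "max_weight L R \<le> W \<longleftrightarrow> (\<forall>l\<in>set L \<union> set R. form_weight_le W l)"
proof -
  let ?W = "\<lambda>(a :: int vec, b). insert (nat \<bar>b\<bar>) ((\<lambda>i. nat \<bar>a $ i\<bar>) ` {..<dim_vec a})"
  have "finite (\<Union>l\<in>set L \<union> set R. ?W l)" "(\<Union>l\<in>set L \<union> set R. ?W l) \<noteq> {}"
    using assms by (auto simp: neq_Nil_conv)
  then have "max_weight L R \<le> W \<longleftrightarrow> (\<forall>l\<in>set L \<union> set R. \<forall>w\<in>?W l. w \<le> W)"
    unfolding max_weight_def by (subst Max_le_iff) blast+
  moreover have "(\<forall>w\<in>?W l. w \<le> W) \<longleftrightarrow> form_weight_le W l" for l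
    by (auto simp: form_weight_le_def nat_le_iff split: prod.splits)
  ultimately show ?thesis by simp
qed

section \<open>Min-plus polynomial threshold functions are closed under substitution\<close>

text \<open>A coordinate that copies a variable is a unit row with constant 0; a constant coordinate
  is a zero row.\<close>

lemma substitution_affine:
  assumes "substitution n m v"
  obtains D :: "nat \<Rightarrow> nat \<Rightarrow> int" and C :: "nat \<Rightarrow> int"
  where "\<And>x j. x \<in> carrier_vec n \<Longrightarrow> j < m \<Longrightarrow>
            of_bool (v x $ j) = (\<Sum>i<n. D j i * of_bool (x $ i)) + C j"
    and "\<And>j i. D j i \<in> {0, 1}" and "\<And>j. C j \<in> {0, 1}"
proof -
  define row where "row j d c \<longleftrightarrow> (\<forall>x\<in>carrier_vec n. of_bool (v x $ j) = (\<Sum>i<n. d i * of_bool (x $ i)) + c)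
      \<and> (\<forall>i. d i \<in> {0, 1}) \<and> c \<in> {0, 1}" for j :: nat and d :: "nat \<Rightarrow> int" and c :: int
  have "\<exists>d c. j < m \<longrightarrow> row j d c" for j
  proof (cases "j < m")
    case True
    then consider i where "i < n" "\<forall>x\<in>carrier_vec n. v x $ j = x $ i"
      | c where "\<forall>x\<in>carrier_vec n. v x $ j = c"
      using assms unfolding substitution_def by blast
    then show ?thesis
    proof cases
      case 1
      then have "row j (\<lambda>k. of_bool (k = i)) 0"
        unfolding row_def by (auto simp: of_bool_def if_distrib[of "\<lambda>z. z * _"] cong: if_cong)
      then show ?thesis by blast
    next
      case 2
      then have "row j (\<lambda>_. 0) (of_bool c)" unfolding row_def by auto
      then show ?thesis by blast
    qed
  qed auto
  then obtain D C where DC: "\<And>j. j < m \<Longrightarrow> row j (D j) (C j)" by metis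
  show thesis
  \<comment> \<open>Rows from \<open>m\<close> on are set to zero so that the 0/1 facts hold for all
    indices.\<close>
  proof (rule that[of "\<lambda>j i. if j < m then D j i else 0" "\<lambda>j. if j < m then C j else 0"])
  qed (use DC in \<open>auto simp: row_def\<close>)
qed

text \<open>Composing with the affine coordinates of \<open>v\<close> keeps a form affine. Each new
  coefficient is a sum of at most \<open>m\<close> old ones, and the new constant also includes the
  old constant, whence the factor \<open>m + 1\<close>.\<close>

lemma form_substitution:
  assumes "substitution n m v"
  obtains h :: "affine_form \<Rightarrow> affine_form"
  where "\<And>l. fst (h l) \<in> carrier_vec n"
    and "\<And>l x. x \<in> carrier_vec n \<Longrightarrow> form_val (h l) x = form_val l (v x)"
    and "\<And>l W. fst l \<in> carrier_vec m \<Longrightarrow> form_weight_le W l \<Longrightarrow> form_weight_le ((m + 1) * W) (h l)"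
proof -
  obtain D :: "nat \<Rightarrow> nat \<Rightarrow> int" and C where
    v: "\<And>x j. x \<in> carrier_vec n \<Longrightarrow> j < m \<Longrightarrow>
            of_bool (v x $ j) = (\<Sum>i<n. D j i * of_bool (x $ i)) + C j"
    and D: "\<And>j i. D j i \<in> {0, 1}" and C: "\<And>j. C j \<in> {0, 1}"
    by (rule substitution_affine[OF assms]) (rule that)
  define h :: "affine_form \<Rightarrow> affine_form" where
    "h l = (vec n (\<lambda>i. \<Sum>j<m. fst l $ j * D j i), (\<Sum>j<m. fst l $ j * C j) + snd l)" for l
  have bound: "\<bar>\<Sum>j<m. a $ j * e j\<bar> \<le> int m * int W"
    if "\<And>j. e j \<in> {0, 1}" "\<And>j. j < m \<Longrightarrow> \<bar>a $ j\<bar> \<le> int W" for a :: "int vec" and e W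
  proof -
    have "\<bar>a $ j * e j\<bar> \<le> int W" if "j < m" for j
      using \<open>\<And>j. e j \<in> {0, 1}\<close>[of j] \<open>\<And>j. j < m \<Longrightarrow> \<bar>a $ j\<bar> \<le> int W\<close>[OF that] by auto
    then have "(\<Sum>j<m. \<bar>a $ j * e j\<bar>) \<le> (\<Sum>j<m. int W)" by (intro sum_mono) auto
    from order_trans[OF sum_abs this] show ?thesis by simp
  qed
  show thesis
  proof (rule that[of h])
    show "fst (h l) \<in> carrier_vec n" for l by (simp add: h_def)
  next
    fix l :: affine_form and x :: "bool vec" assume x: "x \<in> carrier_vec n"
    have vx: "v x \<in> carrier_vec m" using assms x by (auto simp: substitution_def)
    have "form_val l (v x) = (\<Sum>j<m. fst l $ j * ((\<Sum>i<n. D j i * of_bool (x $ i)) + C j)) + snd l"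
      unfolding form_val_sum[OF vx] by (simp add: v[OF x])
    also have "\<dots> = (\<Sum>j<m. \<Sum>i<n. fst l $ j * D j i * of_bool (x $ i)) + (\<Sum>j<m. fst l $ j * C j) + snd l"
      by (simp add: distrib_left sum.distrib sum_distrib_left mult.assoc del: sum_mult_of_bool_eq)
    also have "(\<Sum>j<m. \<Sum>i<n. fst l $ j * D j i * of_bool (x $ i)) =
        (\<Sum>i<n. (\<Sum>j<m. fst l $ j * D j i) * of_bool (x $ i))"
      by (subst sum.swap) (simp add: sum_distrib_right del: sum_mult_of_bool_eq)
    also have "\<dots> + (\<Sum>j<m. fst l $ j * C j) + snd l = form_val (h l) x"
      unfolding form_val_sum[OF x] h_def by simp
    finally show "form_val (h l) x = form_val l (v x)" ..
  next
    fix l :: affine_form and W assume "fst l \<in> carrier_vec m" "form_weight_le W l"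
    then have a: "\<And>j. j < m \<Longrightarrow> \<bar>fst l $ j\<bar> \<le> int W" and b: "\<bar>snd l\<bar> \<le> int W"
      by (auto simp: form_weight_le_def)
    have W: "int ((m + 1) * W) = int m * int W + int W" by (simp add: distrib_right)
    have DW: "\<bar>\<Sum>j<m. fst l $ j * D j i\<bar> \<le> int m * int W" for i by (rule bound[OF D a])
    have "\<bar>\<Sum>j<m. fst l $ j * D j i\<bar> \<le> int ((m + 1) * W)" for i
      using DW[of i] unfolding W by linarith
    moreover have "\<bar>\<Sum>j<m. fst l $ j * C j\<bar> \<le> int m * int W" by (rule bound[OF C a])
    then have "\<bar>(\<Sum>j<m. fst l $ j * C j) + snd l\<bar> \<le> int ((m + 1) * W)"
      using b unfolding W by linarith
    ultimately show "form_weight_le ((m + 1) * W) (h l)"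
      by (simp add: form_weight_le_def h_def del: of_nat_mult of_nat_add)
  qed
qed

lemma mpptf_subfunction:
  assumes g: "mpptf_computes m g L R" and sub: "is_subfunction n f m g"
  obtains L' R' where "mpptf_computes n f L' R'" "length L' + length R' = length L + length R"
    "max_weight L' R' \<le> (m + 1) * max_weight L R"
proof -
  obtain v where v: "substitution n m v" and f: "\<And>x. x \<in> carrier_vec n \<Longrightarrow> f x = g (v x)"
    using sub by (auto simp: is_subfunction_def)
  obtain h where h: "\<And>l. fst (h l) \<in> carrier_vec n"
      "\<And>l x. x \<in> carrier_vec n \<Longrightarrow> form_val (h l) x = form_val l (v x)"
      "\<And>l W. fst l \<in> carrier_vec m \<Longrightarrow> form_weight_le W l \<Longrightarrow> form_weight_le ((m + 1) * W) (h l)"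
    by (rule form_substitution[OF v]) (rule that)
  have LR: "L \<noteq> []" "R \<noteq> []" "\<And>l. l \<in> set L \<union> set R \<Longrightarrow> fst l \<in> carrier_vec m"
    using g by (auto simp: mpptf_computes_def)
  have "mpptf_computes n f (map h L) (map h R)"
    unfolding mpptf_computes_def
  proof (intro conjI ballI)
    fix x :: "bool vec" assume x: "x \<in> carrier_vec n"
    then have "v x \<in> carrier_vec m" using v by (auto simp: substitution_def)
    then show "f x \<longleftrightarrow> (MIN l\<in>set (map h L). form_val l x) \<le> (MIN r\<in>set (map h R). form_val r x)"
      using g f[OF x] h(2)[OF x] by (simp add: mpptf_computes_def image_image)
  qed (use LR h(1) in auto)
  moreover have "\<forall>l\<in>set L \<union> set R. form_weight_le (max_weight L R) l"
    using max_weight_le_iff[of L R "max_weight L R"] LR by simp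
  then have "max_weight (map h L) (map h R) \<le> (m + 1) * max_weight L R"
  proof (subst max_weight_le_iff)
    show "map h L \<noteq> [] \<or> map h R \<noteq> []" using LR by simp
    show "\<forall>l\<in>set (map h L) \<union> set (map h R). form_weight_le ((m + 1) * max_weight L R) l"
      if "\<forall>l\<in>set L \<union> set R. form_weight_le (max_weight L R) l"
    proof
      fix l' assume "l' \<in> set (map h L) \<union> set (map h R)"
      then obtain l where "l \<in> set L \<union> set R" "l' = h l" by auto
      with that LR(3) h(3) show "form_weight_le ((m + 1) * max_weight L R) l'" by blast
    qed
  qed
  ultimately show thesis using that[of "map h L" "map h R"] by simp
qed

section \<open>Closure of the two threshold classes under subfunctions\<close>

lemma mpPTF_unboundedI:
  assumes "\<And>n. n \<ge> 1 \<Longrightarrow> \<exists>L R. mpptf_computes n (f n) L R \<and> length L + length R \<le> s n"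
    and "poly_bounded s"
  shows "f \<in> mpPTF_unbounded"
proof -
  obtain L R where "\<And>n. n \<ge> 1 \<Longrightarrow> mpptf_computes n (f n) (L n) (R n) \<and> length (L n) + length (R n) \<le> s n"
    using assms(1) by metis
  then show ?thesis
    unfolding mpPTF_unbounded_def by (blast intro: poly_bounded_mono[OF assms(2)])
qed

lemma mpPTF_polyI:
  assumes "\<And>n. n \<ge> 1 \<Longrightarrow> \<exists>L R. mpptf_computes n (f n) L R \<and> length L + length R \<le> s n \<and> max_weight L R \<le> w n"
    and "poly_bounded s" "poly_bounded w"
  shows "f \<in> mpPTF_poly"
proof -
  obtain L R where "\<And>n. n \<ge> 1 \<Longrightarrow> mpptf_computes n (f n) (L n) (R n) \<and>
      length (L n) + length (R n) \<le> s n \<and> max_weight (L n) (R n) \<le> w n"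
    using assms(1) by metis
  then show ?thesis
    unfolding mpPTF_poly_def
    by (blast intro: poly_bounded_mono[OF assms(2)] poly_bounded_mono[OF assms(3)])
qed

lemma subfun_closure_mono: "C \<subseteq> D \<Longrightarrow> subfun_closure C \<subseteq> subfun_closure D"
  unfolding subfun_closure_def by blast

lemma subfun_closure_mpPTF_unbounded: "subfun_closure mpPTF_unbounded \<subseteq> mpPTF_unbounded"
proof
  fix f assume "f \<in> subfun_closure mpPTF_unbounded"
  then obtain g m L R where m: "poly_bounded m" "\<And>n. n \<ge> 1 \<Longrightarrow> m n \<ge> 1"
    and sub: "\<And>n. n \<ge> 1 \<Longrightarrow> is_subfunction n (f n) (m n) (g (m n))"
    and g: "\<And>n. n \<ge> 1 \<Longrightarrow> mpptf_computes n (g n) (L n) (R n)"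
    and s: "poly_bounded (\<lambda>n. length (L n) + length (R n))"
    unfolding subfun_closure_def mpPTF_unbounded_def by blast
  show "f \<in> mpPTF_unbounded"
  proof (rule mpPTF_unboundedI[OF _ poly_bounded_compose[OF s m]])
    fix n :: nat assume n: "n \<ge> 1"
    from mpptf_subfunction[OF g[OF m(2)[OF n]] sub[OF n]]
    show "\<exists>L' R'. mpptf_computes n (f n) L' R' \<and> length L' + length R' \<le> length (L (m n)) + length (R (m n))"
      by (metis order_refl)
  qed
qed

lemma subfun_closure_mpPTF_poly: "subfun_closure mpPTF_poly \<subseteq> mpPTF_poly"
proof
  fix f assume "f \<in> subfun_closure mpPTF_poly"
  then obtain g m L R where m: "poly_bounded m" "\<And>n. n \<ge> 1 \<Longrightarrow> m n \<ge> 1"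
    and sub: "\<And>n. n \<ge> 1 \<Longrightarrow> is_subfunction n (f n) (m n) (g (m n))"
    and g: "\<And>n. n \<ge> 1 \<Longrightarrow> mpptf_computes n (g n) (L n) (R n)"
    and s: "poly_bounded (\<lambda>n. length (L n) + length (R n))"
    and w: "poly_bounded (\<lambda>n. max_weight (L n) (R n))"
    unfolding subfun_closure_def mpPTF_poly_def by blast
  have w': "poly_bounded (\<lambda>n. (m n + 1) * max_weight (L (m n)) (R (m n)))"
    by (intro poly_bounded_mult poly_bounded_add poly_bounded_const m poly_bounded_compose[OF w])
  show "f \<in> mpPTF_poly"
  proof (rule mpPTF_polyI[OF _ poly_bounded_compose[OF s m] w'])
    fix n :: nat assume n: "n \<ge> 1"
    from mpptf_subfunction[OF g[OF m(2)[OF n]] sub[OF n]]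
    show "\<exists>L' R'. mpptf_computes n (f n) L' R' \<and>
        length L' + length R' \<le> length (L (m n)) + length (R (m n)) \<and>
        max_weight L' R' \<le> (m n + 1) * max_weight (L (m n)) (R (m n))"
      by (metis order_refl)
  qed
qed

section \<open>Nearest neighbor representations as min-plus threshold functions\<close>

text \<open>Only strict comparisons of distances need to be preserved: every input has a strict
  winner, in \<open>P\<close> or in \<open>N\<close>, and its form then wins as well. If
  \<open>P\<close> or \<open>N\<close> is empty, constant forms 0 and 1 are used instead, since both
  lists must be nonempty; this is what the extra 2 terms and the extra weight 1 allow for.\<close>

lemma nn_rep_mpptf:
  assumes rep: "nn_rep n f P N"
    and carr: "\<And>p. p \<in> P \<union> N \<Longrightarrow> fst (\<phi> p) \<in> carrier_vec n"
    and mono: "\<And>x p q. x \<in> carrier_vec n \<Longrightarrow> p \<in> P \<union> N \<Longrightarrow> q \<in> P \<union> N \<Longrightarrow>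
      sq_dist (embed x) p < sq_dist (embed x) q \<Longrightarrow> form_val (\<phi> p) x < form_val (\<phi> q) x"
  obtains L R where "mpptf_computes n f L R" "length L + length R \<le> card P + card N + 2"
    "\<And>W. \<forall>p\<in>P \<union> N. form_weight_le W (\<phi> p) \<Longrightarrow> max_weight L R \<le> W + 1"
proof -
  have fin: "finite P" "finite N"
    and fT: "\<And>x. x \<in> carrier_vec n \<Longrightarrow> f x \<longleftrightarrow> (\<exists>p\<in>P. \<forall>q\<in>N. sq_dist (embed x) p < sq_dist (embed x) q)"
    and fF: "\<And>x. x \<in> carrier_vec n \<Longrightarrow> \<not> f x \<longleftrightarrow> (\<exists>q\<in>N. \<forall>p\<in>P. sq_dist (embed x) q < sq_dist (embed x) p)"
    using rep unfolding nn_rep_def by blast+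
  have const: "form_val (0\<^sub>v n, b) x = b" if "x \<in> carrier_vec n" for b x
    using that by (simp add: form_val_sum)
  have cw: "form_weight_le (Suc W) (0\<^sub>v n, b)" if "b \<in> {0, 1}" for b W
    using that by (auto simp: form_weight_le_def)
  \<comment> \<open>Any point of the cube would do: it has to be classified, so \<open>P\<close> and
    \<open>N\<close> are not both empty.\<close>
  have "vec n (\<lambda>_. False) \<in> carrier_vec n" by simp
  from fT[OF this] fF[OF this] consider "P = {}" "N \<noteq> {}" | "N = {}" "P \<noteq> {}" | "P \<noteq> {}" "N \<noteq> {}"
    by blast
  then show thesis
  proof cases
    case 1
    then show thesis
      by (intro that[of "[(0\<^sub>v n, 1)]" "[(0\<^sub>v n, 0)]"])
        (auto simp: mpptf_computes_def const fT max_weight_le_iff cw)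
  next
    case 2
    then show thesis
      by (intro that[of "[(0\<^sub>v n, 0)]" "[(0\<^sub>v n, 1)]"])
        (auto simp: mpptf_computes_def const fT max_weight_le_iff cw)
  next
    case 3
    obtain ps qs where ps: "set ps = P" "length ps = card P" and qs: "set qs = N" "length qs = card N"
      using finite_distinct_list[OF fin(1)] finite_distinct_list[OF fin(2)] by (metis distinct_card)
    have ne: "ps \<noteq> []" "qs \<noteq> []" using 3 ps qs by auto
    have "f x \<longleftrightarrow> (\<exists>p\<in>P. \<forall>q\<in>N. form_val (\<phi> p) x \<le> form_val (\<phi> q) x)" if x: "x \<in> carrier_vec n" for x
    proof
      assume "f x"
      then show "\<exists>p\<in>P. \<forall>q\<in>N. form_val (\<phi> p) x \<le> form_val (\<phi> q) x"
        using fT[OF x] mono[OF x] by (meson UnI1 UnI2 less_imp_le)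
    next
      assume "\<exists>p\<in>P. \<forall>q\<in>N. form_val (\<phi> p) x \<le> form_val (\<phi> q) x"
      then show "f x"
        using fF[OF x] mono[OF x] by (meson UnI1 UnI2 not_le)
    qed
    then have "mpptf_computes n f (map \<phi> ps) (map \<phi> qs)"
      using ne carr ps qs unfolding mpptf_computes_def
      by (auto simp add: image_image Min_image_le_iff 3 fin simp del: Min_le_iff Min_ge_iff)
    moreover have step: "form_weight_le (W + 1) l" if "form_weight_le W l" for l W
      using that by (force simp: form_weight_le_def)
    then have "max_weight (map \<phi> ps) (map \<phi> qs) \<le> W + 1" if "\<forall>p\<in>P \<union> N. form_weight_le W (\<phi> p)" for W
    proof (subst max_weight_le_iff)
      show "\<forall>l\<in>set (map \<phi> ps) \<union> set (map \<phi> qs). form_weight_le (W + 1) l"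
      proof
        fix l assume "l \<in> set (map \<phi> ps) \<union> set (map \<phi> qs)"
        then obtain p where "p \<in> P \<union> N" "l = \<phi> p" using ps qs by auto
        then show "form_weight_le (W + 1) l" using that step by blast
      qed
    qed (use ne in auto)
    ultimately show thesis using that ps qs by simp
  qed
qed

text \<open>Up to the term \<open>\<Sum>i<n. x $ i\<close> common to all anchors, the squared distance to \<open>p\<close> is an affine
  form in \<open>x\<close>; this is that form scaled by \<open>M\<close> and rounded.\<close>

definition anchor_form :: "nat \<Rightarrow> real \<Rightarrow> real vec \<Rightarrow> affine_form" where
  "anchor_form n M p = (vec n (\<lambda>i. \<lfloor>- 2 * M * p $ i\<rfloor>), \<lfloor>M * (\<Sum>i<n. (p $ i)\<^sup>2)\<rfloor>)"

text \<open>Rounding changes each of the \<open>n\<close> coefficients, which are multiplied by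
  bits, and the constant term by at most 1.\<close>

lemma anchor_form_approx:
  assumes x: "x \<in> carrier_vec n"
  shows "\<bar>M * (sq_dist (embed x) p - (\<Sum>i<n. of_bool (x $ i))) - of_int (form_val (anchor_form n M p) x)\<bar> \<le> real n + 1"
proof -
  define e where "e i = (- 2 * M * p $ i - \<lfloor>- 2 * M * p $ i\<rfloor>) * of_bool (x $ i)" for i
  define d where "d = M * (\<Sum>i<n. (p $ i)\<^sup>2) - \<lfloor>M * (\<Sum>i<n. (p $ i)\<^sup>2)\<rfloor>"
  have "M * (sq_dist (embed x) p - (\<Sum>i<n. of_bool (x $ i))) - of_int (form_val (anchor_form n M p) x)
      = (\<Sum>i<n. e i) + d"
    unfolding sq_dist_embed_expand[OF x] form_val_sum[OF x] anchor_form_def e_def d_def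
    by (simp add: algebra_simps sum_subtractf sum_distrib_left sum_negf)
  moreover have "\<bar>e i\<bar> \<le> 1" for i unfolding e_def by (simp add: of_bool_def) linarith
  then have "\<bar>\<Sum>i<n. e i\<bar> \<le> (\<Sum>i<n. 1)"
    by (intro order_trans[OF sum_abs] sum_mono)
  moreover have "\<bar>d\<bar> \<le> 1" unfolding d_def by linarith
  ultimately show ?thesis by simp
qed

lemma NN_subset_mpPTF: "NN \<subseteq> mpPTF_unbounded"
proof
  fix f assume "f \<in> NN"
  then obtain P N where rep: "\<And>n. n \<ge> 1 \<Longrightarrow> nn_rep n (f n) (P n) (N n)"
    and s: "poly_bounded (\<lambda>n. card (P n) + card (N n))"
    unfolding NN_def by blast
  show "f \<in> mpPTF_unbounded"
  proof (rule mpPTF_unboundedI[OF _ poly_bounded_add[OF s poly_bounded_const[of 2]]])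
    fix n :: nat assume n: "n \<ge> 1"
    let ?A = "P n \<union> N n"
    have fin: "finite ?A" using rep[OF n] by (simp add: nn_rep_def)
    \<comment> \<open>There are only finitely many strict comparisons, so one factor
      \<open>M\<close> serves them all. The gap \<open>2 * (real n + 1)\<close> is twice the error
      in \<open>anchor_form_approx\<close>.\<close>
    define T where "T = {t \<in> carrier_vec n \<times> ?A \<times> ?A. case t of (x, p, q) \<Rightarrow> sq_dist (embed x) p < sq_dist (embed x) q}"
    have "finite T" unfolding T_def using fin finite_bool_cube by simp
    moreover have "\<forall>t\<in>T. \<forall>\<^sub>F M in at_top. case t of (x, p, q) \<Rightarrow>
        2 * (real n + 1) < M * (sq_dist (embed x) q - sq_dist (embed x) p)"
    proof
      fix t assume "t \<in> T"
      then obtain x p q where t: "t = (x, p, q)" and "sq_dist (embed x) p < sq_dist (embed x) q"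
        by (auto simp: T_def)
      then have "0 < sq_dist (embed x) q - sq_dist (embed x) p" by simp
      then show "\<forall>\<^sub>F M in at_top. case t of (x, p, q) \<Rightarrow>
          2 * (real n + 1) < M * (sq_dist (embed x) q - sq_dist (embed x) p)"
        unfolding t prod.case
        using eventually_gt_at_top[of "2 * (real n + 1) / (sq_dist (embed x) q - sq_dist (embed x) p)"]
        by (auto simp: pos_divide_less_eq elim!: eventually_mono)
    qed
    ultimately have "\<forall>\<^sub>F M in at_top. \<forall>t\<in>T. case t of (x, p, q) \<Rightarrow>
        2 * (real n + 1) < M * (sq_dist (embed x) q - sq_dist (embed x) p)"
      by (rule eventually_ball_finite)
    then obtain M where M: "\<And>x p q. (x, p, q) \<in> T \<Longrightarrow>
        2 * (real n + 1) < M * (sq_dist (embed x) q - sq_dist (embed x) p)"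
      unfolding eventually_at_top_linorder by fast
    have mono: "form_val (anchor_form n M p) x < form_val (anchor_form n M q) x"
      if "x \<in> carrier_vec n" "p \<in> ?A" "q \<in> ?A" "sq_dist (embed x) p < sq_dist (embed x) q" for x p q
    proof -
      have "2 * (real n + 1) < M * (sq_dist (embed x) q - sq_dist (embed x) p)"
        using that by (intro M) (simp add: T_def)
      with anchor_form_approx[OF that(1), of M p] anchor_form_approx[OF that(1), of M q]
      show ?thesis by (simp add: algebra_simps)
    qed
    show "\<exists>L R. mpptf_computes n (f n) L R \<and> length L + length R \<le> card (P n) + card (N n) + 2"
      by (rule nn_rep_mpptf[OF rep[OF n], of "anchor_form n M"])
        (use mono in \<open>auto simp: anchor_form_def\<close>)
  qed
qed

lemma HNN_subset_mpPTF: "HNN \<subseteq> mpPTF_poly"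
proof
  fix f assume "f \<in> HNN"
  then obtain P N where rep: "\<And>n. n \<ge> 1 \<Longrightarrow> hnn_rep n (f n) (P n) (N n)"
    and s: "poly_bounded (\<lambda>n. card (P n) + card (N n))"
    unfolding HNN_def by blast
  have w: "poly_bounded (\<lambda>n. n + 2 + 1)"
    by (intro poly_bounded_add poly_bounded_id poly_bounded_const)
  show "f \<in> mpPTF_poly"
  proof (rule mpPTF_polyI[OF _ poly_bounded_add[OF s poly_bounded_const[of 2]] w])
    fix n :: nat assume n: "n \<ge> 1"
    let ?A = "P n \<union> N n"
    have nn: "nn_rep n (f n) (P n) (N n)" and A: "?A \<subseteq> embed ` carrier_vec n"
      using rep[OF n] by (auto simp: hnn_rep_def)
    \<comment> \<open>With Boolean anchors and scale 1 the rounded quantities are already integers,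
      so the form is exact.\<close>
    have val: "of_int (form_val (anchor_form n 1 p) x) = sq_dist (embed x) p - (\<Sum>i<n. of_bool (x $ i))"
      if p: "p \<in> ?A" and x: "x \<in> carrier_vec n" for p x
    proof -
      obtain z where z: "z \<in> carrier_vec n" "p = embed z" using p A by blast
      have "\<lfloor>- 2 * 1 * p $ i\<rfloor> = - 2 * of_bool (z $ i)" if "i < n" for i
        using that z by auto
      moreover have "(\<Sum>i<n. (p $ i)\<^sup>2) = of_int (\<Sum>i<n. of_bool (z $ i))"
        using z by (auto simp: power2_eq_square intro!: sum.cong)
      ultimately show ?thesis
        unfolding sq_dist_embed_expand[OF x] form_val_sum[OF x] anchor_form_def
        using z by (auto intro!: sum.cong)
    qed
    have mono: "form_val (anchor_form n 1 p) x < form_val (anchor_form n 1 q) x"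
      if "x \<in> carrier_vec n" "p \<in> ?A" "q \<in> ?A" "sq_dist (embed x) p < sq_dist (embed x) q" for x p q
      using val[OF that(2,1)] val[OF that(3,1)] that(4) by linarith
    \<comment> \<open>Coefficients are 0 or -2 and the constant counts the ones of the anchor, at
      most \<open>n\<close>.\<close>
    have weight: "form_weight_le (n + 2) (anchor_form n 1 p)" if p: "p \<in> ?A" for p
    proof -
      obtain z where z: "z \<in> carrier_vec n" "p = embed z" using p A by blast
      have "(\<Sum>i<n. (p $ i)\<^sup>2) \<le> (\<Sum>i<n. 1)" using z by (intro sum_mono) auto
      moreover have "0 \<le> (\<Sum>i<n. (p $ i)\<^sup>2)" by (intro sum_nonneg) auto
      ultimately show ?thesis
        using z by (auto simp: form_weight_le_def anchor_form_def of_bool_def) linarith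
    qed
    have carr: "fst (anchor_form n 1 p) \<in> carrier_vec n" for p by (simp add: anchor_form_def)
    show "\<exists>L R. mpptf_computes n (f n) L R \<and> length L + length R \<le> card (P n) + card (N n) + 2 \<and>
        max_weight L R \<le> n + 2 + 1"
      by (rule nn_rep_mpptf[OF nn carr mono]) (use weight in blast)+
  qed
qed

section \<open>Min-plus threshold functions as subfunctions of nearest neighbor functions\<close>

text \<open>Without ties between the two sets, if no anchor of \<open>P\<close> beats all of
  \<open>N\<close>, then a nearest anchor of \<open>N\<close> beats all of \<open>P\<close>.\<close>

lemma nn_rep_of_separated:
  assumes fin: "finite P" "finite N" and carr: "P \<subseteq> carrier_vec m" "N \<subseteq> carrier_vec m"
    and ne: "P \<noteq> {} \<or> N \<noteq> {}"
    and sep: "\<And>y p q. y \<in> carrier_vec m \<Longrightarrow> p \<in> P \<Longrightarrow> q \<in> N \<Longrightarrow>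
      sq_dist (embed y) p \<noteq> sq_dist (embed y) q"
  shows "nn_rep m (\<lambda>y. \<exists>p\<in>P. \<forall>q\<in>N. sq_dist (embed y) p < sq_dist (embed y) q) P N"
proof -
  \<comment> \<open>A common anchor would tie with itself.\<close>
  have disj: "P \<inter> N = {}" using sep[of "vec m (\<lambda>_. False)"] by auto
  have key: "(\<not> (\<exists>p\<in>P. \<forall>q\<in>N. d p < d q)) \<longleftrightarrow> (\<exists>q\<in>N. \<forall>p\<in>P. d q < d p)"
    if d: "\<And>p q. p \<in> P \<Longrightarrow> q \<in> N \<Longrightarrow> d p \<noteq> d q" for d :: "real vec \<Rightarrow> real"
  proof
    assume *: "\<not> (\<exists>p\<in>P. \<forall>q\<in>N. d p < d q)"
    then have "N \<noteq> {}" using ne by blast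
    then have "Min (d ` N) \<in> d ` N" using fin by (intro Min_in) auto
    then obtain q where q: "q \<in> N" "Min (d ` N) = d q" by blast
    have "d q < d p" if p: "p \<in> P" for p
    proof -
      obtain q' where "q' \<in> N" "d q' \<le> d p" using * p by force
      moreover have "d q \<le> d q'" using fin \<open>q' \<in> N\<close> by (simp flip: q(2))
      ultimately show ?thesis using d[OF p q(1)] by linarith
    qed
    then show "\<exists>q\<in>N. \<forall>p\<in>P. d q < d p" using q by blast
  next
    assume "\<exists>q\<in>N. \<forall>p\<in>P. d q < d p"
    then show "\<not> (\<exists>p\<in>P. \<forall>q\<in>N. d p < d q)" by force
  qed
  show ?thesis
    unfolding nn_rep_def by (intro conjI ballI fin carr disj refl key sep)
qed

text \<open>The terms \<open>2 * L\<close> and \<open>2 * R + 1\<close> never coincide, so that \<open>\<le>\<close> in the threshold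
  function turns into the strict comparison of distances.\<close>

lemma mpptf_realization:
  fixes A :: "int \<Rightarrow> affine_form \<Rightarrow> real vec"
  assumes f: "mpptf_computes n f L R" and v: "substitution n m v"
    and carr: "\<And>s l. A s l \<in> carrier_vec m"
    and dist: "\<And>x s l. x \<in> carrier_vec n \<Longrightarrow> s \<in> {0, 1} \<Longrightarrow> l \<in> set L \<union> set R \<Longrightarrow>
      sq_dist (embed (v x)) (A s l) = c x + 2 * of_int (form_val l x) + of_int s"
    and sep: "\<And>y l r. y \<in> carrier_vec m \<Longrightarrow> l \<in> set L \<Longrightarrow> r \<in> set R \<Longrightarrow>
      sq_dist (embed y) (A 0 l) \<noteq> sq_dist (embed y) (A 1 r)"
  obtains g P N where "nn_rep m g P N" "P \<subseteq> range (A 0)" "N \<subseteq> range (A 1)"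
    "card P + card N \<le> length L + length R" "is_subfunction n f m g"
proof -
  let ?P = "A 0 ` set L" and ?N = "A 1 ` set R"
  let ?g = "\<lambda>y. \<exists>p\<in>?P. \<forall>q\<in>?N. sq_dist (embed y) p < sq_dist (embed y) q"
  have ne: "L \<noteq> []" "R \<noteq> []" using f by (auto simp: mpptf_computes_def)
  have "f x = ?g (v x)" if x: "x \<in> carrier_vec n" for x
  proof -
    have "f x \<longleftrightarrow> (\<exists>l\<in>set L. \<forall>r\<in>set R. form_val l x \<le> form_val r x)"
      using f x ne by (simp add: mpptf_computes_def Min_image_le_iff del: Min_le_iff Min_ge_iff)
    moreover have "form_val l x \<le> form_val r x \<longleftrightarrow>
        sq_dist (embed (v x)) (A 0 l) < sq_dist (embed (v x)) (A 1 r)"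
      if "l \<in> set L" "r \<in> set R" for l r
      using that x by (simp add: dist) linarith
    ultimately show ?thesis by simp
  qed
  then have "is_subfunction n f m ?g" using v unfolding is_subfunction_def by blast
  moreover have "nn_rep m ?g ?P ?N"
    by (rule nn_rep_of_separated) (use carr sep ne in auto)
  moreover have "card ?P + card ?N \<le> length L + length R"
    by (intro add_mono order_trans[OF card_image_le card_length]) auto
  ultimately show thesis by (intro that[of ?g ?P ?N]) auto
qed

text \<open>An extra coordinate, set to \<open>0\<close> by the substitution, adjusts the norms of the anchors. When
  \<open>C\<close> is large its values \<open>sqrt (C + \<delta>)\<close> differ by less than \<open>1/2\<close>, which excludes ties
  also on the inputs where the extra coordinate is \<open>1\<close>.\<close>

lemma mpptf_nn:
  assumes f: "mpptf_computes n f L R"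
  obtains g P N where "nn_rep (Suc n) g P N" "card P + card N \<le> length L + length R"
    "is_subfunction n f (Suc n) g"
proof -
  \<comment> \<open>With first coordinates \<open>- a\<close> the squared distance contains
    \<open>2 * a * x\<close> and the squares of the \<open>a\<close>. Beyond a common
    \<open>C\<close>, the square of the last coordinate must supply \<open>\<delta> s l\<close> to
    replace those squares by twice the constant term plus \<open>s\<close>.\<close>
  define \<delta> :: "int \<Rightarrow> affine_form \<Rightarrow> real" where "\<delta> s l = 2 * of_int (snd l) + of_int s - (\<Sum>i<n. (of_int (fst l $ i))\<^sup>2)" for s l
  define E where "E = insert 0 ((\<lambda>(s, l). \<bar>\<delta> s l\<bar>) ` ({0, 1} \<times> (set L \<union> set R)))"
  define T where "T = Max E"
  have "finite E" unfolding E_def by simp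
  then have E: "e \<le> T" if "e \<in> E" for e using that unfolding T_def by simp
  have T0: "0 \<le> T" by (rule E) (simp add: E_def)
  have T: "\<bar>\<delta> s l\<bar> \<le> T" if "s \<in> {0, 1}" "l \<in> set L \<union> set R" for s l
    by (rule E) (use that in \<open>force simp: E_def\<close>)
  \<comment> \<open>\<open>C + \<delta> s l\<close> lies between \<open>(2 * T + 1)\<^sup>2\<close>
    and that plus \<open>2 * T\<close>, hence below \<open>(2 * T + 3 / 2)\<^sup>2\<close>: all
    roots fall into an interval of length 1/2.\<close>
  define C where "C = T + (2 * T + 1)\<^sup>2"
  define t where "t s l = sqrt (C + \<delta> s l)" for s l
  define A where "A s l = vec (Suc n) (\<lambda>j. if j < n then - of_int (fst l $ j) else t s l)" for s l
  define v :: "bool vec \<Rightarrow> bool vec" where "v x = vec (Suc n) (\<lambda>j. j < n \<and> x $ j)" for x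
  have t: "(t s l)\<^sup>2 = C + \<delta> s l" "2 * T + 1 \<le> t s l" "t s l < 2 * T + 3 / 2"
    if sl: "s \<in> {0, 1}" "l \<in> set L \<union> set R" for s l
  proof -
    have lower: "(2 * T + 1)\<^sup>2 \<le> C + \<delta> s l" using T[OF sl] unfolding C_def by linarith
    then have "0 \<le> C + \<delta> s l" by (meson order_trans zero_le_power2)
    then show "(t s l)\<^sup>2 = C + \<delta> s l" unfolding t_def by simp
    show "2 * T + 1 \<le> t s l" unfolding t_def using lower by (rule real_le_rsqrt)
    have "C + \<delta> s l < (2 * T + 3 / 2)\<^sup>2"
      using T[OF sl] T0 unfolding C_def by (simp add: power2_eq_square algebra_simps)
    then show "t s l < 2 * T + 3 / 2"
      unfolding t_def using T0 by (intro real_less_lsqrt) auto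
  qed
  \<comment> \<open>Computed on the whole larger cube because \<open>sep\<close> needs it there; the
    last summand vanishes on the image of \<open>v\<close>.\<close>
  have dist: "sq_dist (embed y) (A s l) = (\<Sum>i<n. of_bool (y $ i)) + C
      + 2 * of_int (form_val l (vec n (\<lambda>i. y $ i))) + of_int s + of_bool (y $ n) * (1 - 2 * t s l)"
    if y: "y \<in> carrier_vec (Suc n)" and sl: "s \<in> {0, 1}" "l \<in> set L \<union> set R" for y s l
  proof -
    have "sq_dist (embed y) (A s l) =
        (\<Sum>i<n. (of_bool (y $ i) + of_int (fst l $ i))\<^sup>2) + (of_bool (y $ n) - t s l)\<^sup>2"
      unfolding sq_dist_embed[OF y] A_def by simp
    also have "(\<Sum>i<n. (of_bool (y $ i) + of_int (fst l $ i))\<^sup>2) = (\<Sum>i<n. of_bool (y $ i))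
        + 2 * (\<Sum>i<n. of_int (fst l $ i) * of_bool (y $ i)) + (\<Sum>i<n. (real_of_int (fst l $ i))\<^sup>2)"
      unfolding sum_distrib_left sum.distrib[symmetric]
      by (rule sum.cong) (auto simp: power2_eq_square algebra_simps)
    also have "(of_bool (y $ n) - t s l)\<^sup>2 = of_bool (y $ n) * (1 - 2 * t s l) + (C + \<delta> s l)"
      unfolding t(1)[OF sl, symmetric] by (auto simp: power2_eq_square algebra_simps)
    finally show ?thesis
      by (simp add: form_val_sum[of _ n] \<delta>_def)
  qed
  have sub: "substitution n (Suc n) v"
    unfolding substitution_def v_def by auto
  have carr: "A s l \<in> carrier_vec (Suc n)" for s l by (simp add: A_def)
  have dist': "sq_dist (embed (v x)) (A s l) =
      ((\<Sum>i<n. of_bool (x $ i)) + C) + 2 * of_int (form_val l x) + of_int s"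
    if x: "x \<in> carrier_vec n" and sl: "s \<in> {0, 1}" "l \<in> set L \<union> set R" for x s l
  proof -
    have "v x \<in> carrier_vec (Suc n)" by (simp add: v_def)
    moreover have "vec n (\<lambda>i. v x $ i) = x" using x by (auto simp: v_def)
    ultimately show ?thesis using sl by (subst dist) (auto simp: v_def)
  qed
  have sep: "sq_dist (embed y) (A 0 l) \<noteq> sq_dist (embed y) (A 1 r)"
    if y: "y \<in> carrier_vec (Suc n)" and lr: "l \<in> set L" "r \<in> set R" for y l r
  proof
    define k where "k = form_val l (vec n (\<lambda>i. y $ i)) - form_val r (vec n (\<lambda>i. y $ i))"
    define e where "e = of_bool (y $ n) * (t 0 l - t 1 r)"
    assume "sq_dist (embed y) (A 0 l) = sq_dist (embed y) (A 1 r)"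
    \<comment> \<open>The left side is an odd integer, while the right side has absolute value below
      1.\<close>
    then have ke: "2 * of_int k - 1 = 2 * e"
      using lr by (simp add: dist[OF y] k_def e_def algebra_simps)
    have "2 * T + 1 \<le> t 0 l" "t 0 l < 2 * T + 3 / 2" "2 * T + 1 \<le> t 1 r" "t 1 r < 2 * T + 3 / 2"
      using t(2,3)[of 0 l] t(2,3)[of 1 r] lr by simp_all
    then have "\<bar>t 0 l - t 1 r\<bar> < 1 / 2" by linarith
    then have "\<bar>e\<bar> < 1 / 2" by (cases "y $ n") (simp_all add: e_def)
    with ke have "0 < k \<and> k < 1" by linarith
    then show False by linarith
  qed
  show thesis
    by (rule mpptf_realization[OF f sub carr dist' sep]) (assumption | rule that)+
qed

section \<open>Boolean anchors built from blocks of repeated variables\<close>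

lemma sum_lessThan_add:
  "(\<Sum>j<a + b. F j) = (\<Sum>j<a. F j) + (\<Sum>j<b. F (a + j :: nat) :: 'a :: comm_monoid_add)"
  by (induction b) (simp_all add: add.assoc)

lemma sum_blocks:
  "(\<Sum>j<n * K. F j) = (\<Sum>i<n. \<Sum>r<K. F (i * K + r :: nat) :: 'a :: comm_monoid_add)"
  by (induction n) (simp_all add: sum_lessThan_add add.commute[of K])

text \<open>A block of \<open>K\<close> bits whose first \<open>t\<close> bits are ones realizes any
  count up to \<open>K\<close>; the Boolean anchors consist of such blocks.\<close>

lemma sum_threshold:
  assumes "0 \<le> t" "t \<le> int K"
  shows "(\<Sum>r<K. of_bool (int r < t)) = t"
proof -
  have "{..<K} \<inter> {r. int r < t} = {..<nat t}" using assms by auto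
  then show ?thesis using assms by (simp add: sum_of_bool_eq)
qed

lemma sq_dist_embed_embed:
  assumes "y \<in> carrier_vec m" "z \<in> carrier_vec m"
  shows "sq_dist (embed y) (embed z) = of_int (\<Sum>j<m. of_bool (y $ j \<noteq> z $ j))"
  unfolding sq_dist_embed[OF assms(1)] of_int_sum
  by (rule sum.cong) (use assms(2) in \<open>auto simp: power2_eq_square\<close>)

text \<open>In each coordinate the three bits sum to 0 or 2. Hence anchors with weights of different
  parity are never equally far from a point.\<close>

lemma hamming_parity:
  fixes y z :: "bool vec"
  shows "even ((\<Sum>j<m. of_bool (y $ j \<noteq> z $ j)) + (\<Sum>j<m. of_bool (y $ j)) + (\<Sum>j<m. of_bool (z $ j) :: int))"
  unfolding sum.distrib[symmetric] by (rule dvd_sum) auto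

text \<open>Every variable is repeated \<open>2 * W\<close> times, so that an anchor with \<open>W - a\<close> ones among the
  copies of a variable contributes \<open>W - a + 2 * a * x\<close> to the distance; the remaining coordinates
  are set to \<open>0\<close> and adjust the constant term. The anchors of the two kinds have weights of
  different parity, which excludes ties on the whole cube.\<close>

lemma mpptf_hnn:
  assumes f: "mpptf_computes n f L R" and W: "max_weight L R \<le> W"
  obtains g P N where "hnn_rep (4 * (n + 1) * W + 1) g P N" "card P + card N \<le> length L + length R"
    "is_subfunction n f (4 * (n + 1) * W + 1) g"
proof -
  \<comment> \<open>The number of ones \<open>W - a\<close> ranges from 0 to \<open>2 * W\<close>,
    so a block needs \<open>2 * W\<close> positions.\<close>
  define K where "K = 2 * W"
  \<comment> \<open>The largest possible value of \<open>h s l\<close>: the terms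
    \<open>2 * snd l\<close> and the coefficient sum are at most \<open>2 * W\<close> and
    \<open>n * W\<close> in absolute value, and \<open>s\<close> is at most 1.\<close>
  define D where "D = 2 * (n + 2) * W + 1"
  define m where "m = n * K + D"
  have m: "m = 4 * (n + 1) * W + 1" by (simp add: m_def K_def D_def algebra_simps)
  define v :: "bool vec \<Rightarrow> bool vec" where "v x = vec m (\<lambda>j. j < n * K \<and> x $ (j div K))" for x
  \<comment> \<open>The coefficient sum cancels the \<open>- a\<close> left over by the blocks, and
    the offset \<open>(n + 2) * W\<close> makes the count nonnegative.\<close>
  define h :: "int \<Rightarrow> affine_form \<Rightarrow> int"
    where "h s l = 2 * snd l + s + (\<Sum>i<n. fst l $ i) + (int n + 2) * int W" for s l
  define B :: "int \<Rightarrow> affine_form \<Rightarrow> bool vec" where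
    "B s l = vec m (\<lambda>j. if j < n * K then int (j mod K) < int W - fst l $ (j div K)
                        else int (j - n * K) < h s l)" for s l
  have "L \<noteq> []" using f by (simp add: mpptf_computes_def)
  then have weight: "form_weight_le W l" if "l \<in> set L \<union> set R" for l
    using max_weight_le_iff[of L R W] W that by blast
  have lcarr: "fst l \<in> carrier_vec n" if "l \<in> set L \<union> set R" for l
    using f that by (auto simp: mpptf_computes_def)
  have v: "v x \<in> carrier_vec m" for x by (simp add: v_def)
  have B: "B s l \<in> carrier_vec m" for s l by (simp add: B_def)
  have ham: "(\<Sum>j<m. of_bool (v x $ j \<noteq> B s l $ j)) = (2 * int n + 2) * int W + 2 * form_val l x + s"
    if x: "x \<in> carrier_vec n" and sl: "s \<in> {0, 1}" "l \<in> set L \<union> set R" for x s l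
  proof -
    let ?a = "fst l"
    have a: "\<bar>?a $ i\<bar> \<le> int W" if "i < n" for i
      using weight[OF sl(2)] lcarr[OF sl(2)] that by (auto simp: form_weight_le_def)
    have b: "\<bar>snd l\<bar> \<le> int W" using weight[OF sl(2)] by (simp add: form_weight_le_def)
    have "\<bar>\<Sum>i<n. ?a $ i\<bar> \<le> (\<Sum>i<n. int W)"
      by (rule order_trans[OF sum_abs], rule sum_mono) (use a in auto)
    then have h: "0 \<le> h s l" "h s l \<le> int D"
      using b sl(1) unfolding h_def D_def by (auto simp: algebra_simps)
    have block: "(\<Sum>r<K. of_bool (v x $ (i * K + r) \<noteq> B s l $ (i * K + r))) =
        int W - ?a $ i + 2 * (?a $ i * of_bool (x $ i))" if i: "i < n" for i
    proof -
      have idx: "i * K + r < n * K" "(i * K + r) div K = i" "(i * K + r) mod K = r" if "r < K" for r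
      proof -
        have "i * K + r < Suc i * K" using that by simp
        also have "\<dots> \<le> n * K" using i by (intro mult_le_mono1) simp
        finally show "i * K + r < n * K" .
      qed (use that in auto)
      have "(\<Sum>r<K. of_bool (v x $ (i * K + r) \<noteq> B s l $ (i * K + r))) =
          (\<Sum>r<K. of_bool (x $ i \<noteq> (int r < int W - ?a $ i)) :: int)"
        using idx by (intro sum.cong) (auto simp: v_def B_def m_def trans_less_add1)
      \<comment> \<open>Writing the exclusive or of bits \<open>b\<close> and \<open>c\<close> as
        \<open>b + (1 - 2 * b) * c\<close> makes the sum linear in the anchor bits, so that
        \<open>sum_threshold\<close> applies.\<close>
      also have "\<dots> = (\<Sum>r<K. of_bool (x $ i) + (1 - 2 * of_bool (x $ i)) * of_bool (int r < int W - ?a $ i))"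
        by (intro sum.cong) auto
      also have "\<dots> = int K * of_bool (x $ i) + (1 - 2 * of_bool (x $ i)) * (int W - ?a $ i)"
        using a[OF i] by (simp add: sum.distrib flip: sum_distrib_left del: sum_of_bool_eq) (simp add: sum_threshold K_def del: sum_of_bool_eq)
      also have "\<dots> = int W - ?a $ i + 2 * (?a $ i * of_bool (x $ i))"
        by (simp add: K_def)
      finally show ?thesis .
    qed
    have "(\<Sum>j<m. of_bool (v x $ j \<noteq> B s l $ j)) =
        (\<Sum>i<n. \<Sum>r<K. of_bool (v x $ (i * K + r) \<noteq> B s l $ (i * K + r))) +
        (\<Sum>j<D. of_bool (v x $ (n * K + j) \<noteq> B s l $ (n * K + j)))"
      unfolding m_def sum_lessThan_add sum_blocks ..
    also have "(\<Sum>j<D. of_bool (v x $ (n * K + j) \<noteq> B s l $ (n * K + j))) = (\<Sum>j<D. of_bool (int j < h s l))"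
      by (intro sum.cong) (auto simp: v_def B_def m_def)
    also have "\<dots> = h s l" using h by (rule sum_threshold)
    also have "(\<Sum>i<n. \<Sum>r<K. of_bool (v x $ (i * K + r) \<noteq> B s l $ (i * K + r))) =
        (\<Sum>i<n. int W - ?a $ i + 2 * (?a $ i * of_bool (x $ i)))"
      by (intro sum.cong refl block) simp
    also have "\<dots> = int n * int W - (\<Sum>i<n. ?a $ i) + 2 * (\<Sum>i<n. ?a $ i * of_bool (x $ i))"
      by (simp add: sum.distrib sum_subtractf sum_distrib_left del: sum_of_bool_eq sum_mult_of_bool_eq)
    finally show ?thesis
      unfolding form_val_sum[OF x] h_def by (simp add: algebra_simps)
  qed
  have sub: "substitution n m v"
    unfolding substitution_def
  proof (intro conjI allI impI)
    fix j assume "j < m"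
    show "(\<exists>i<n. \<forall>x\<in>carrier_vec n. v x $ j = x $ i) \<or> (\<exists>c. \<forall>x\<in>carrier_vec n. v x $ j = c)"
    proof (cases "j < n * K")
      case True
      then have "j div K < n" by (rule less_mult_imp_div_less)
      with True \<open>j < m\<close> show ?thesis by (auto simp: v_def)
    qed (use \<open>j < m\<close> in \<open>auto simp: v_def\<close>)
  qed (use v in auto)
  have carr: "embed (B s l) \<in> carrier_vec m" for s l using B by simp
  have dist: "sq_dist (embed (v x)) (embed (B s l)) = of_int ((2 * int n + 2) * int W) + 2 * of_int (form_val l x) + of_int s"
    if "x \<in> carrier_vec n" "s \<in> {0, 1}" "l \<in> set L \<union> set R" for x s l
    unfolding sq_dist_embed_embed[OF v B] ham[OF that] by simp
  have sep: "sq_dist (embed y) (embed (B 0 l)) \<noteq> sq_dist (embed y) (embed (B 1 r))"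
    if y: "y \<in> carrier_vec m" and lr: "l \<in> set L" "r \<in> set R" for y l r
  proof
    \<comment> \<open>The parities of the anchor weights are not computed but compared through the
      distances from one point \<open>v x\<close>, known from \<open>ham\<close>. A tie at
      \<open>y\<close> would make the two weights agree in parity.\<close>
    define x where "x = vec n (\<lambda>_. False)"
    have x: "x \<in> carrier_vec n" by (simp add: x_def)
    assume "sq_dist (embed y) (embed (B 0 l)) = sq_dist (embed y) (embed (B 1 r))"
    then have "(\<Sum>j<m. of_bool (y $ j \<noteq> B 0 l $ j)) = (\<Sum>j<m. of_bool (y $ j \<noteq> B 1 r $ j) :: int)"
      unfolding sq_dist_embed_embed[OF y B] of_int_eq_iff .
    with hamming_parity[of y "B 0 l" m] hamming_parity[of y "B 1 r" m]
      hamming_parity[of "v x" "B 0 l" m] hamming_parity[of "v x" "B 1 r" m]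
    have "even ((\<Sum>j<m. of_bool (v x $ j \<noteq> B 0 l $ j)) + (\<Sum>j<m. of_bool (v x $ j \<noteq> B 1 r $ j)) :: int)"
      by presburger
    moreover have "(\<Sum>j<m. of_bool (v x $ j \<noteq> B 0 l $ j)) = (2 * int n + 2) * int W + 2 * form_val l x + 0"
      "(\<Sum>j<m. of_bool (v x $ j \<noteq> B 1 r $ j)) = (2 * int n + 2) * int W + 2 * form_val r x + 1"
      using lr by (intro ham x; simp)+
    ultimately show False by (simp del: sum_of_bool_eq)
  qed
  obtain g P N where g: "nn_rep m g P N" "P \<subseteq> range (\<lambda>l. embed (B 0 l))" "N \<subseteq> range (\<lambda>l. embed (B 1 l))"
    "card P + card N \<le> length L + length R" "is_subfunction n f m g"
    by (rule mpptf_realization[OF f sub carr dist sep]) (assumption | rule that)+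
  then have "hnn_rep m g P N" using B unfolding hnn_rep_def by blast
  with g(4,5) show thesis using that unfolding m by blast
qed

section \<open>From a function for each dimension to a single family\<close>

text \<open>Abstracts from the kind of representation, so that the collection into a family is
  carried out once for \<open>NN\<close> and \<open>HNN\<close>.\<close>

definition anchor_class ::
    "(nat \<Rightarrow> (bool vec \<Rightarrow> bool) \<Rightarrow> real vec set \<Rightarrow> real vec set \<Rightarrow> bool) \<Rightarrow> bool_family set" where
  "anchor_class Q = {f. \<exists>P N. (\<forall>n\<ge>1. Q n (f n) (P n) (N n)) \<and>
                              poly_bounded (\<lambda>n. card (P n) + card (N n))}"

text \<open>Since \<open>M\<close> is injective, the functions obtained for the single \<open>n\<close> can be collected in one
  family; \<open>n \<le> M n\<close> turns bounds in \<open>n\<close> into bounds in the dimension \<open>M n\<close>.\<close>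

lemma subfun_closure_anchor_classI:
  assumes inj: "inj_on M {1..}" and M: "\<And>n. n \<ge> 1 \<Longrightarrow> n \<le> M n" "poly_bounded M"
    and s: "poly_bounded s"
    and triv: "\<And>m. \<exists>g P N. Q m g P N \<and> card P + card N \<le> 1"
    and rep: "\<And>n. n \<ge> 1 \<Longrightarrow>
      \<exists>g P N. Q (M n) g P N \<and> card P + card N \<le> s n \<and> is_subfunction n (f n) (M n) g"
  shows "f \<in> subfun_closure (anchor_class Q)"
proof -
  obtain c k where ck: "\<And>n. n \<ge> 1 \<Longrightarrow> s n \<le> c * n ^ k" using s unfolding poly_bounded_def by blast
  \<comment> \<open>The \<open>+ 1\<close> leaves room for the one anchor of a filler function even
    if \<open>c = 0\<close>.\<close>
  have "\<exists>g P N. m \<ge> 1 \<longrightarrow> Q m g P N \<and> card P + card N \<le> (c + 1) * m ^ k \<and>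
      (\<forall>n\<ge>1. M n = m \<longrightarrow> is_subfunction n (f n) m g)" for m
  proof (cases "m \<in> M ` {1..}")
    case True
    then obtain n where n: "n \<ge> 1" "m = M n" by auto
    obtain g P N where g: "Q m g P N" "card P + card N \<le> s n" "is_subfunction n (f n) m g"
      using rep[OF n(1)] n(2) by blast
    have "s n \<le> c * n ^ k" by (rule ck[OF n(1)])
    also have "\<dots> \<le> (c + 1) * m ^ k" using M(1)[OF n(1)] n(2) by (intro mult_mono power_mono) auto
    finally have "card P + card N \<le> (c + 1) * m ^ k" using g(2) by linarith
    moreover have "n' = n" if "n' \<ge> 1" "M n' = m" for n'
      using inj that n by (auto dest: inj_onD)
    ultimately show ?thesis using g by blast
  next
    case False
    \<comment> \<open>A dimension that is not a value of \<open>M\<close> carries no condition from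
      \<open>f\<close>, so any represented function fills it.\<close>
    obtain g P N where g: "Q m g P N" "card P + card N \<le> 1" using triv by blast
    have "card P + card N \<le> (c + 1) * m ^ k" if "m \<ge> 1"
      using g(2) one_le_power[OF that, of k] by (simp add: trans_le_add1)
    with g(1) False show ?thesis by auto
  qed
  then obtain g P N where g: "\<And>m. m \<ge> 1 \<Longrightarrow> Q m (g m) (P m) (N m)"
    "\<And>m. m \<ge> 1 \<Longrightarrow> card (P m) + card (N m) \<le> (c + 1) * m ^ k"
    "\<And>m n. m \<ge> 1 \<Longrightarrow> n \<ge> 1 \<Longrightarrow> M n = m \<Longrightarrow> is_subfunction n (f n) m (g m)"
    by metis
  have "g \<in> anchor_class Q" unfolding anchor_class_def using g(1) poly_boundedI[OF g(2)] by blast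
  moreover have "M n \<ge> 1 \<and> is_subfunction n (f n) (M n) (g (M n))" if "n \<ge> 1" for n
    using M(1)[OF that] that g(3)[of "M n" n] by simp
  ultimately show ?thesis unfolding subfun_closure_def using M(2) by blast
qed

lemma hnn_rep_True: "hnn_rep m (\<lambda>_. True) {embed (vec m (\<lambda>_. False))} {}"
  by (auto simp: hnn_rep_def nn_rep_def)

lemma mpPTF_subset_closure_NN: "mpPTF_unbounded \<subseteq> subfun_closure NN"
proof
  fix f assume "f \<in> mpPTF_unbounded"
  then obtain L R where f: "\<And>n. n \<ge> 1 \<Longrightarrow> mpptf_computes n (f n) (L n) (R n)"
    and s: "poly_bounded (\<lambda>n. length (L n) + length (R n))"
    unfolding mpPTF_unbounded_def by blast
  have "f \<in> subfun_closure (anchor_class nn_rep)"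
  proof (rule subfun_closure_anchor_classI[of Suc, OF _ _ _ s])
    show "poly_bounded Suc"
      using poly_bounded_add[OF poly_bounded_id poly_bounded_const[of 1]] by simp
    show "\<exists>g P N. nn_rep m g P N \<and> card P + card N \<le> 1" for m
      using hnn_rep_True[of m] unfolding hnn_rep_def by force
    show "\<exists>g P N. nn_rep (Suc n) g P N \<and> card P + card N \<le> length (L n) + length (R n) \<and>
        is_subfunction n (f n) (Suc n) g" if "n \<ge> 1" for n
      by (rule mpptf_nn[OF f[OF that]]) blast
  qed auto
  then show "f \<in> subfun_closure NN" by (simp add: NN_def anchor_class_def)
qed

lemma mpPTF_subset_closure_HNN: "mpPTF_poly \<subseteq> subfun_closure HNN"
proof
  fix f assume "f \<in> mpPTF_poly"
  then obtain L R where f: "\<And>n. n \<ge> 1 \<Longrightarrow> mpptf_computes n (f n) (L n) (R n)"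
    and s: "poly_bounded (\<lambda>n. length (L n) + length (R n))"
    and w: "poly_bounded (\<lambda>n. max_weight (L n) (R n))"
    unfolding mpPTF_poly_def by blast
  obtain c k where ck: "\<And>n. n \<ge> 1 \<Longrightarrow> max_weight (L n) (R n) \<le> c * n ^ k"
    using w unfolding poly_bounded_def by blast
  \<comment> \<open>The polynomial bound replaces the actual weight because it is monotone; the
    \<open>+ 1\<close> keeps it positive. Thus \<open>M\<close> is strictly increasing, which yields
    both injectivity and \<open>n \<le> M n\<close>.\<close>
  define W where "W n = c * n ^ k + 1" for n
  define M where "M n = 4 * (n + 1) * W n + 1" for n
  have "strict_mono M"
  proof (rule strict_monoI)
    fix a b :: nat assume "a < b"
    then have "W a \<le> W b" by (auto simp: W_def intro!: mult_left_mono power_mono)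
    then have "4 * (a + 1) * W a \<le> 4 * (a + 1) * W b" by (rule mult_left_mono) simp
    also have "\<dots> < 4 * (b + 1) * W b" using \<open>a < b\<close> by (intro mult_strict_right_mono) (auto simp: W_def)
    finally show "M a < M b" by (simp add: M_def)
  qed
  have "f \<in> subfun_closure (anchor_class hnn_rep)"
  proof (rule subfun_closure_anchor_classI[of M, OF _ _ _ s])
    show "inj_on M {1..}" using \<open>strict_mono M\<close> by (meson inj_on_subset strict_mono_imp_inj_on subset_UNIV)
    show "n \<le> M n" for n using \<open>strict_mono M\<close> by (rule strict_mono_imp_increasing)
    have "poly_bounded W" by (rule poly_boundedI[of _ "c + 1" k]) (simp add: W_def)
    then show "poly_bounded M"
      unfolding M_def by (intro poly_bounded_add poly_bounded_mult poly_bounded_const poly_bounded_id)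
    show "\<exists>g P N. hnn_rep m g P N \<and> card P + card N \<le> 1" for m
      using hnn_rep_True[of m] by force
    show "\<exists>g P N. hnn_rep (M n) g P N \<and> card P + card N \<le> length (L n) + length (R n) \<and>
        is_subfunction n (f n) (M n) g" if "n \<ge> 1" for n
    proof -
      have "max_weight (L n) (R n) \<le> W n" using ck[OF that] by (simp add: W_def)
      then show ?thesis unfolding M_def by (rule mpptf_hnn[OF f[OF that]]) blast
    qed
  qed
  then show "f \<in> subfun_closure HNN" by (simp add: HNN_def anchor_class_def)
qed

theorem theorem1:
  shows "subfun_closure NN = mpPTF_unbounded \<and> subfun_closure HNN = mpPTF_poly"
  using subfun_closure_mono[OF NN_subset_mpPTF] subfun_closure_mpPTF_unbounded
    subfun_closure_mono[OF HNN_subset_mpPTF] subfun_closure_mpPTF_poly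
    mpPTF_subset_closure_NN mpPTF_subset_closure_HNN
  by blast

end
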